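(* Let $T$ be a tree of order $n\ge 3$. Then $\iota(\mathrm{Mid}(T))\le \lfloor \frac{n-1}{2}\rfloor$. Moreover, this bound is sharp: for every $n\ge 3$ there exists a tree $T$ of order $n$ with $\iota(\mathrm{Mid}(T))= \lfloor \frac{n-1}{2}\rfloor$.
   Context: For a graph $H$ and $S\subseteq V(H)$, let $N_H[S]$ be $S$ together with all vertices adjacent to a vertex of $S$. A set $S\subseteq V(H)$ is an isolating set of $H$ if $V(H)\setminus N_H[S]$ is an independent set of $H$; $\iota(H)$ is the minimum size of an isolating set of $H$. The middle graph $\mathrm{Mid}(G)$ has vertex set $V(G)\cup\{m_e: e\in E(G)\}$, with $v\sim m_e$ iff $v$ is an endpoint of $e$, $m_e\sim m_f$ iff distinct edges $e,f$ share an endpoint, and no edges between vertices of $V(G)$. *)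

theory Defs
  imports "Graph_Theory.Graph_Theory"
begin

text \<open>
  A finite simple graph is a symmetric loop-free digraph (locale \<^locale>\<open>pair_graph\<close>);
  \<open>u\<close> and \<open>v\<close> are adjacent iff \<open>(u, v) \<in> parcs G\<close>.
\<close>

text \<open>
  The predicate \<^const>\<open>tree\<close> of the library is meant for digraphs: in a symmetric digraph, every
  edge traversed back and forth is a \<^const>\<open>pre_digraph.cycle\<close>. In a simple graph, the cycles
  in the undirected sense are exactly those of length at least 3.
\<close>

definition undirected_tree :: "'a pair_pre_digraph \<Rightarrow> bool" where
  "undirected_tree G \<longleftrightarrow>
     pair_graph G \<and> connected (with_proj G) \<and>
     \<not> (\<exists>p. pre_digraph.cycle (with_proj G) p \<and> length p \<ge> 3)"

definition undirected_edges :: "'a pair_pre_digraph \<Rightarrow> 'a set set" where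
  "undirected_edges G = {{u, v} | u v. (u, v) \<in> parcs G}"

definition closed_nbhd :: "'a pair_pre_digraph \<Rightarrow> 'a set \<Rightarrow> 'a set" where
  "closed_nbhd G S = S \<union> {v. \<exists>u\<in>S. (u, v) \<in> parcs G}"

definition independent_set :: "'a pair_pre_digraph \<Rightarrow> 'a set \<Rightarrow> bool" where
  "independent_set G A \<longleftrightarrow> A \<subseteq> pverts G \<and> (\<forall>u\<in>A. \<forall>v\<in>A. (u, v) \<notin> parcs G)"

definition isolating_set :: "'a pair_pre_digraph \<Rightarrow> 'a set \<Rightarrow> bool" where
  "isolating_set G S \<longleftrightarrow> S \<subseteq> pverts G \<and> independent_set G (pverts G - closed_nbhd G S)"

definition isolation_number :: "'a pair_pre_digraph \<Rightarrow> nat" where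
  "isolation_number G = (LEAST k. \<exists>S. isolating_set G S \<and> card S = k)"

text \<open>\<open>Inl v\<close> is the original vertex \<open>v\<close>, and \<open>Inr e\<close> is the vertex \<open>m\<^sub>e\<close> of the edge \<open>e\<close>.\<close>

definition middle_graph :: "'a pair_pre_digraph \<Rightarrow> ('a + 'a set) pair_pre_digraph" where
  "middle_graph G =
     \<lparr> pverts = Inl ` pverts G \<union> Inr ` undirected_edges G,
       parcs = {(Inl v, Inr e) | v e. e \<in> undirected_edges G \<and> v \<in> e}
             \<union> {(Inr e, Inl v) | v e. e \<in> undirected_edges G \<and> v \<in> e}
             \<union> {(Inr e, Inr f) | e f. e \<in> undirected_edges G \<and> f \<in> undirected_edges G
                                    \<and> e \<noteq> f \<and> e \<inter> f \<noteq> {}} \<rparr>"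

lemma isolating_set_pverts: "isolating_set G (pverts G)"
  by (auto simp: isolating_set_def independent_set_def closed_nbhd_def)

lemma pair_graph_middle_graph:
  assumes "pair_graph G"
  shows "pair_graph (middle_graph G)"
proof -
  interpret pair_graph G by fact
  let ?M = "middle_graph G"
  have "undirected_edges G \<subseteq> Pow (pverts G)"
    by (auto simp: undirected_edges_def dest: in_arcsD1 in_arcsD2)
  then have sub: "e \<subseteq> pverts G" if "e \<in> undirected_edges G" for e
    using that by blast
  have fin: "finite (pverts ?M)"
    using pair_finite_verts finite_subset[OF \<open>undirected_edges G \<subseteq> _\<close>]
    by (simp add: middle_graph_def)
  have arcs: "parcs ?M \<subseteq> pverts ?M \<times> pverts ?M"
    using sub by (auto simp: middle_graph_def)
  show ?thesis
  proof unfold_locales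
    show "finite (parcs ?M)"
      using arcs fin by (meson finite_SigmaI finite_subset)
    show "symmetric (with_proj ?M)"
      by (auto simp: symmetric_def sym_def middle_graph_def)
    show "fst e \<noteq> snd e" if "e \<in> parcs ?M" for e
      using that by (auto simp: middle_graph_def)
  qed (use arcs fin in auto)
qed

end

theory Submission
  imports Defs
begin

text \<open>
  A set isolates the middle graph iff the vertices it contains, together with the endpoints of the
  edges it contains, form a vertex cover of the original graph. Let \<open>X\<close>, \<open>Y\<close> be the colour classes
  of a tree, and let \<open>r \<in> X\<close> be a leaf with neighbour \<open>s\<close>. Then \<open>Y\<close> is a vertex cover, and \<open>X - {r}\<close>
  misses only the edge \<open>rs\<close>, which is covered after replacing some neighbour \<open>x \<noteq> r\<close> of \<open>s\<close> by the
  edge \<open>xs\<close>. The two isolating sets have at most \<open>n - 1\<close> elements in total. The bound is attained by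
  the star with \<open>(n - 1) div 2\<close> subdivided edges (and one further edge if \<open>n\<close> is even), since no
  vertex or edge covers two of the outer edges.
\<close>

section \<open>Cycles, bipartitions and leaves\<close>

text \<open>Induction on the length: a repeated vertex splits the walk into two shorter closed
  walks, one of them odd. Without repetition the walk is itself a cycle, and as there are no loops
  its odd length is at least 3.\<close>

lemma (in loopfree_digraph) odd_closed_walk_imp_cycle:
  assumes "awalk u p u" and "odd (length p)"
  shows "\<exists>c. cycle c \<and> length c \<ge> 3"
  using assms
proof (induction "length p" arbitrary: u p rule: less_induct)
  case less
  obtain e p' where p: "p = e # p'"
    using less.prems by (cases p) auto
  have e: "e \<in> arcs G" "u = tail G e" and p': "awalk (head G e) p' u"
    using less.prems p by (auto simp: awalk_Cons_iff)
  show ?case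
  proof (cases "distinct (awalk_verts (head G e) p')")
    case True
    then have c: "cycle p"
      using less.prems p by (auto simp: cycle_def)
    then have "length p \<ge> 2"
      by (auto simp: cycle_digraph_conv)
    with less.prems have "length p \<ge> 3"
      by (cases "length p = 2") auto
    with c show ?thesis by blast
  next
    case False
    obtain q c s w where dec: "p' = q @ c @ s" "0 < length c"
      and w: "awalk (head G e) q w" "awalk w c w" "awalk w s u"
      using awalk_not_distinct_decomp[OF p' False] by blast
    have qs: "awalk u (e # q @ s) u"
      using e awalk_appendI[OF w(1,3)] by (simp add: awalk_Cons_iff)
    show ?thesis
    proof (cases "odd (length c)")
      case True
      then show ?thesis
        using less.hyps[of c w] w dec p by simp
    next
      case False
      then have "odd (length (e # q @ s))"
        using less.prems p dec by simp
      then show ?thesis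
        using less.hyps[of "e # q @ s" u] qs dec p by simp
    qed
  qed
qed

text \<open>The classes record the parity of walks from \<open>r\<close>. For a vertex reached with
  both parities, one walk back to \<open>r\<close> would close one of the two walks to an odd closed
  walk, and hence yield a long cycle.\<close>

lemma (in loopfree_digraph) strongly_connected_bipartition:
  assumes "strongly_connected G" and "\<not> (\<exists>c. cycle c \<and> length c \<ge> 3)" and "r \<in> verts G"
  obtains X Y where "X \<union> Y = verts G" "X \<inter> Y = {}" "r \<in> X"
    "\<And>u v. u \<rightarrow>\<^bsub>G\<^esub> v \<Longrightarrow> u \<in> X \<longleftrightarrow> v \<in> Y"
proof
  define X where "X = {v. \<exists>p. awalk r p v \<and> even (length p)}"
  define Y where "Y = {v. \<exists>p. awalk r p v \<and> odd (length p)}"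
  have walk: "\<exists>p. awalk u p v" if "u \<in> verts G" "v \<in> verts G" for u v
    using assms(1) that by (auto simp: strongly_connected_def reachable_awalk)
  show un: "X \<union> Y = verts G"
    using walk[OF assms(3)] by (fastforce simp: X_def Y_def dest: awalk_last_in_verts)
  show disj: "X \<inter> Y = {}"
  proof (rule ccontr)
    assume "X \<inter> Y \<noteq> {}"
    then obtain v p q where pq: "awalk r p v" "even (length p)" "awalk r q v" "odd (length q)"
      by (auto simp: X_def Y_def)
    obtain b where b: "awalk v b r"
      using walk pq(1) awalk_last_in_verts assms(3) by blast
    have "odd (length (p @ b)) \<or> odd (length (q @ b))"
      using pq by auto
    then show False
      using odd_closed_walk_imp_cycle awalk_appendI pq b assms(2) by blast
  qed
  show "r \<in> X"
    using assms(3) by (auto simp: X_def awalk_Nil_iff intro: exI[of _ "[]"])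
  fix u v assume uv: "u \<rightarrow>\<^bsub>G\<^esub> v"
  then obtain e where e: "awalk u [e] v"
    by (metis reachableE arc_implies_awalk)
  have "v \<in> Y" if "u \<in> X"
  proof -
    from that obtain p where "awalk r p u" "even (length p)" by (auto simp: X_def)
    with awalk_appendI[OF this(1) e] show ?thesis by (auto simp: Y_def intro!: exI[of _ "p @ [e]"])
  qed
  moreover have "v \<in> X" if "u \<in> Y"
  proof -
    from that obtain p where "awalk r p u" "odd (length p)" by (auto simp: Y_def)
    with awalk_appendI[OF this(1) e] show ?thesis by (auto simp: X_def intro!: exI[of _ "p @ [e]"])
  qed
  moreover have "u \<in> X \<union> Y"
    using un awalk_hd_in_verts[OF e] by simp
  ultimately show "u \<in> X \<longleftrightarrow> v \<in> Y"
    using disj by blast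
qed

text \<open>The leaf is the first vertex of a longest path.\<close>

lemma (in graph) acyclic_imp_leaf:
  assumes "verts G \<noteq> {}" and "\<not> (\<exists>c. cycle c \<and> length c \<ge> 3)"
  obtains r s where "r \<in> verts G" "\<And>w. r \<rightarrow>\<^bsub>G\<^esub> w \<Longrightarrow> w = s"
proof -
  define P where "P = (\<lambda>k. \<exists>u p v. apath u p v \<and> length p = k)"
  obtain x where "x \<in> verts G" using assms(1) by blast
  then have "apath x [] x" by (simp add: apath_Nil_iff)
  then have "P 0" unfolding P_def by fastforce
  moreover have "\<forall>k. P k \<longrightarrow> k \<le> card (verts G)"
    using length_apath by (auto simp: P_def)
  ultimately obtain m where "P m" and max: "\<And>k. P k \<Longrightarrow> k \<le> m"
    by (metis GreatestI_nat Greatest_le_nat)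
  then obtain r p v where p: "apath r p v" "length p = m"
    by (auto simp: P_def)
  then have aw: "awalk r p v" by (simp add: apath_def)
  show thesis
  proof
    show "r \<in> verts G" using aw by (rule awalk_hd_in_verts)
    fix w assume "r \<rightarrow>\<^bsub>G\<^esub> w"
    then have "w \<rightarrow>\<^bsub>G\<^esub> r" by (rule arcs_ends_symmetric[OF sym_arcs])
    then obtain e where e: "e \<in> arcs G" "tail G e = w" "head G e = r" by blast
    \<comment> \<open>A neighbour of \<open>r\<close> off the path would extend it to a longer
      one.\<close>
    have "w \<in> set (awalk_verts r p)"
    proof (rule ccontr)
      assume "w \<notin> set (awalk_verts r p)"
      then have "apath w (e # p) v"
        using e p by (simp add: apath_Cons_iff)
      then have "P (Suc m)"
        using p(2) unfolding P_def by fastforce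
      then show False using max by fastforce
    qed
    then obtain q q' where dec: "p = q @ q'" and q: "awalk r q w"
      using awalk_decomp[OF aw] by blast
    have "distinct (awalk_verts r q)"
      using p(1) unfolding dec apath_append_iff by (simp add: apath_def)
    \<comment> \<open>The arc from \<open>w\<close> back to \<open>r\<close> closes the initial
      segment \<open>q\<close>. The resulting cycle has fewer than 3 arcs, so \<open>w\<close> is
      the second vertex of the path.\<close>
    then have "cycle (e # q)"
      using e q by (auto simp: cycle_def awalk_Cons_iff intro!: exI[of _ w])
    then have "length q \<le> 1"
      using assms(2) by fastforce
    moreover have "q \<noteq> []"
      using q e no_loops[OF e(1)] by (auto simp: awalk_Nil_iff)
    ultimately obtain f where "q = [f]"
      by (cases q) auto
    with q have "w = head G f"
      by (auto simp: awalk_simps)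
    \<comment> \<open>If the path is a single vertex, then \<open>hd p\<close> is unspecified, but
      in that case \<open>r\<close> has no neighbour \<open>w\<close> at all.\<close>
    with dec \<open>q = [f]\<close> show "w = head G (hd p)"
      by simp
  qed
qed

section \<open>Isolating sets of middle graphs\<close>

definition mid_cover :: "('a + 'a set) set \<Rightarrow> 'a set" where
  "mid_cover S = {v. Inl v \<in> S} \<union> \<Union> {e. Inr e \<in> S}"

text \<open>An uncovered edge leaves the adjacent pair \<open>Inl u\<close>,
  \<open>Inr {u, v}\<close> outside the closed neighbourhood. If every edge is covered, only
  original vertices can remain, and these are pairwise non-adjacent.\<close>

lemma isolating_set_middle_graph_iff:
  assumes "pair_graph G"
  shows "isolating_set (middle_graph G) S \<longleftrightarrow>
    S \<subseteq> pverts (middle_graph G) \<and> (\<forall>(u, v) \<in> parcs G. u \<in> mid_cover S \<or> v \<in> mid_cover S)"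
    (is "_ \<longleftrightarrow> _ \<and> ?cover")
proof (cases "S \<subseteq> pverts (middle_graph G)")
  case S: True
  interpret pair_graph G by fact
  let ?M = "middle_graph G" and ?R = "pverts (middle_graph G) - closed_nbhd (middle_graph G) S"
  have Inl_R: "Inl v \<in> ?R \<longleftrightarrow> v \<in> pverts G \<and> v \<notin> mid_cover S" for v
    using S by (auto simp: closed_nbhd_def middle_graph_def mid_cover_def)
  have Inr_R: "Inr e \<in> ?R \<longleftrightarrow> e \<in> undirected_edges G \<and> e \<inter> mid_cover S = {}" for e
  proof -
    have "e \<noteq> {}" if "e \<in> undirected_edges G"
      using that by (auto simp: undirected_edges_def)
    then show ?thesis
      using S by (fastforce simp: closed_nbhd_def middle_graph_def mid_cover_def)
  qed
  have "independent_set ?M ?R \<longleftrightarrow> ?cover"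
  proof
    assume ind: "independent_set ?M ?R"
    show ?cover
    proof (clarify, rule ccontr)
      fix u v assume uv: "(u, v) \<in> parcs G" "v \<notin> mid_cover S" "u \<notin> mid_cover S"
      then have "{u, v} \<in> undirected_edges G"
        by (auto simp: undirected_edges_def)
      with uv have "Inl u \<in> ?R" "Inr {u, v} \<in> ?R"
        unfolding Inl_R Inr_R by (auto dest: in_arcsD1)
      moreover have "(Inl u, Inr {u, v}) \<in> parcs ?M"
        using \<open>{u, v} \<in> undirected_edges G\<close> by (simp add: middle_graph_def)
      ultimately show False
        using ind unfolding independent_set_def by blast
    qed
  next
    assume cov: ?cover
    have "Inr e \<notin> ?R" for e
      unfolding Inr_R using cov by (auto simp: undirected_edges_def)
    then show "independent_set ?M ?R"
      unfolding independent_set_def by (auto simp: middle_graph_def)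
  qed
  with S show ?thesis by (simp add: isolating_set_def)
qed (simp add: isolating_set_def)

lemma isolation_number_le: "isolating_set G S \<Longrightarrow> isolation_number G \<le> card S"
  unfolding isolation_number_def by (rule Least_le) blast

lemma isolation_number_attained:
  obtains S where "isolating_set G S" "card S = isolation_number G"
proof -
  have "\<exists>S. isolating_set G S \<and> card S = isolation_number G"
    unfolding isolation_number_def
    by (rule LeastI[of _ "card (pverts G)"]) (use isolating_set_pverts in blast)
  with that show thesis by blast
qed

lemma isolation_number_middle_tree_le:
  assumes tree: "undirected_tree T" and card3: "card (pverts T) \<ge> 3"
  shows "isolation_number (middle_graph T) \<le> (card (pverts T) - 1) div 2"
proof -
  interpret pair_graph T using tree by (simp add: undirected_tree_def)
  have con: "strongly_connected (with_proj T)"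
    using tree symmetric_connected_imp_strongly_connected sym_arcs
    by (simp add: undirected_tree_def)
  have acyc: "\<not> (\<exists>c. cycle c \<and> length c \<ge> 3)"
    using tree by (simp add: undirected_tree_def)
  have "pverts T \<noteq> {}" using card3 by auto
  from acyclic_imp_leaf[OF this acyc] obtain r s
    where r: "r \<in> pverts T" and leaf: "\<And>w. (r, w) \<in> parcs T \<Longrightarrow> w = s"
    by blast
  obtain X Y where XY: "X \<union> Y = pverts T" "X \<inter> Y = {}" "r \<in> X"
    and alt: "\<And>u v. (u, v) \<in> parcs T \<Longrightarrow> u \<in> X \<longleftrightarrow> v \<in> Y"
    using strongly_connected_bipartition[OF con acyc r] by blast
  have fin: "finite X" "finite Y"
    using XY(1) pair_finite_verts by (metis finite_Un)+
  have card_T: "card (pverts T) = card X + card Y"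
    using XY fin by (metis card_Un_disjoint)
  \<comment> \<open>Connectivity in the form needed for \<open>s\<close> and \<open>x\<close>: if
    \<open>r\<close> had no neighbour, or \<open>s\<close> none besides \<open>r\<close>, then
    \<open>{r}\<close> or \<open>{r, s}\<close> would contain the whole tree, which has at least 3
    vertices.\<close>
  have closed: "pverts T \<subseteq> A" if "r \<in> A" "\<And>u v. u \<in> A \<Longrightarrow> (u, v) \<in> parcs T \<Longrightarrow> v \<in> A" for A
  proof
    fix v assume "v \<in> pverts T"
    then obtain p where "awalk r p v"
      using con r by (auto simp: strongly_connected_def reachable_awalk)
    from this that(1) show "v \<in> A"
      by (induction p arbitrary: r) (auto simp: awalk_simps dest: that(2))
  qed
  have small: "\<not> pverts T \<subseteq> {a, b}" for a b
  proof
    assume "pverts T \<subseteq> {a, b}"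
    then have "card (pverts T) \<le> card {a, b}" by (intro card_mono) auto
    also have "\<dots> \<le> 2" by (simp add: card_insert_if)
    finally show False using card3 by simp
  qed
  have rs: "(r, s) \<in> parcs T"
    using closed[of "{r}"] leaf small[of r r] by fastforce
  obtain x where x: "(s, x) \<in> parcs T" "x \<noteq> r"
    using closed[of "{r, s}"] leaf small[of r s] by fastforce
  have "s \<in> Y" "x \<in> X" using alt XY rs x arcs_symmetric by blast+
  define S where "S = insert (Inr {s, x}) (Inl ` (X - {r, x}))"
  have "isolating_set (middle_graph T) (Inl ` Y)"
  proof -
    have "mid_cover (Inl ` Y) = Y" by (auto simp: mid_cover_def)
    moreover have "u \<in> Y \<or> v \<in> Y" if "(u, v) \<in> parcs T" for u v
      using alt[OF that] in_arcsD1[OF that] XY(1) by blast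
    moreover have "Inl ` Y \<subseteq> pverts (middle_graph T)"
      using XY(1) by (auto simp: middle_graph_def)
    ultimately show ?thesis
      unfolding isolating_set_middle_graph_iff[OF pair_graph] by blast
  qed
  then have le_Y: "isolation_number (middle_graph T) \<le> card Y"
    using isolation_number_le by (fastforce simp: card_image)
  have cover_S: "mid_cover S = insert s (X - {r})"
    using \<open>x \<in> X\<close> x(2) by (auto simp: mid_cover_def S_def)
  have cov: "u \<in> mid_cover S \<or> v \<in> mid_cover S" if uv: "(u, v) \<in> parcs T" for u v
  proof -
    \<comment> \<open>If the end in \<open>X\<close> is the uncovered vertex \<open>r\<close>, the
      other end is its only neighbour \<open>s\<close>, which is covered.\<close>
    have "u \<in> X \<or> v \<in> X" using alt uv XY in_arcsD1 in_arcsD2 by blast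
    moreover have "(v, u) \<in> parcs T" using uv arcs_symmetric by blast
    ultimately show ?thesis using leaf uv unfolding cover_S by blast
  qed
  have "{s, x} \<in> undirected_edges T"
    using x(1) unfolding undirected_edges_def by blast
  then have "S \<subseteq> pverts (middle_graph T)"
    using XY(1) by (auto simp: S_def middle_graph_def)
  then have "isolating_set (middle_graph T) S"
    using cov by (simp add: isolating_set_middle_graph_iff[OF pair_graph] Ball_def)
  then have "isolation_number (middle_graph T) \<le> card S"
    by (rule isolation_number_le)
  also have "\<dots> \<le> Suc (card (X - {r, x}))"
    using fin(1) by (simp add: S_def card_insert_if card_image)
  also have "card (X - {r, x}) = card X - 2"
    using XY(3) \<open>x \<in> X\<close> x(2) by (simp add: card_Diff_subset)
  finally have le_X: "isolation_number (middle_graph T) \<le> Suc (card X - 2)" .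
  \<comment> \<open>This rules out truncation in \<open>card X - 2\<close>. The two bounds
    \<open>card Y\<close> and \<open>card X - 1\<close> add up to the order minus 1, so the smaller
    is at most half of that.\<close>
  have "card {r, x} \<le> card X"
    using XY(3) \<open>x \<in> X\<close> fin by (intro card_mono) auto
  then have "card X \<ge> 2" using x(2) by simp
  with le_X le_Y card_T show ?thesis by linarith
qed

section \<open>The extremal trees\<close>

definition parent_graph :: "nat \<Rightarrow> (nat \<Rightarrow> nat) \<Rightarrow> nat pair_pre_digraph" where
  "parent_graph n f = \<lparr> pverts = {..<n},
     parcs = {(i, f i) | i. 0 < i \<and> i < n} \<union> {(f i, i) | i. 0 < i \<and> i < n} \<rparr>"

text \<open>Descending through parents connects every vertex to \<open>0\<close>. In a cycle of
  length at least 3, both neighbours of the largest vertex would have to be its parent.\<close>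

lemma undirected_tree_parent_graph:
  assumes "n > 0" and f: "\<And>i. 0 < i \<Longrightarrow> i < n \<Longrightarrow> f i < i"
  shows "undirected_tree (parent_graph n f)"
proof -
  let ?G = "parent_graph n f"
  have sub: "parcs ?G \<subseteq> {..<n} \<times> {..<n}"
    using f by (auto simp: parent_graph_def dest: less_trans)
  have ne: "f i \<noteq> i" if "0 < i" "i < n" for i
    using f[OF that] by simp
  have "pair_graph ?G"
  proof unfold_locales
    show "finite (parcs ?G)"
      using sub by (meson finite_SigmaI finite_lessThan finite_subset)
    show "symmetric (with_proj ?G)"
      by (auto simp: symmetric_def sym_def parent_graph_def)
    show "fst e \<noteq> snd e" if "e \<in> parcs ?G" for e
      using that ne ne[symmetric] by (auto simp: parent_graph_def)
  qed (use sub in \<open>auto simp: parent_graph_def\<close>)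
  then interpret pair_graph ?G .
  have to_0: "i \<rightarrow>\<^sup>*\<^bsub>with_proj ?G\<^esub> 0" if "i < n" for i
    using that
  proof (induction i rule: less_induct)
    case (less i)
    show ?case
    proof (cases "i = 0")
      case True
      then show ?thesis
        using reachable_refl[of 0] assms(1) by (simp add: parent_graph_def del: reachable_refl)
    next
      case False
      then have "i \<rightarrow>\<^bsub>with_proj ?G\<^esub> f i" "f i \<rightarrow>\<^sup>*\<^bsub>with_proj ?G\<^esub> 0"
        using less f[of i] by (auto simp: parent_graph_def)
      then show ?thesis
        using adj_reachable_trans[of i "f i" 0] by simp
    qed
  qed
  have "strongly_connected (with_proj ?G)"
  proof (rule strongly_connectedI)
    show "verts (with_proj ?G) \<noteq> {}" using assms(1) by (auto simp: parent_graph_def)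
    fix u v assume "u \<in> verts (with_proj ?G)" "v \<in> verts (with_proj ?G)"
    then have "u \<rightarrow>\<^sup>*\<^bsub>with_proj ?G\<^esub> 0" "0 \<rightarrow>\<^sup>*\<^bsub>with_proj ?G\<^esub> v"
      using to_0 symmetric_reachable'[OF to_0] by (simp_all add: parent_graph_def)
    then show "u \<rightarrow>\<^sup>*\<^bsub>with_proj ?G\<^esub> v"
      by (rule reachable_trans)
  qed
  then have "connected (with_proj ?G)"
    using reachable_mk_symmetricI by (simp add: connected_def strongly_connected_def)
  moreover have "length p < 3" if cyc: "cycle p" for p
  proof (rule ccontr)
    assume "\<not> length p < 3"
    from cyc obtain u where p: "awalk u p u" "distinct (tl (pawalk_verts u p))" "p \<noteq> []"
      by (auto simp: cycle_def)
    \<comment> \<open>The vertices of a walk after the first one are the heads of its arcs.\<close>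
    have heads: "distinct (map snd p)"
      using p awalk_verts_conv'[of u p u] by (auto simp: awalk_def)
    define m where "m = Max (snd ` set p)"
    have "m \<in> snd ` set p"
      unfolding m_def using p(3) by (intro Max_in) auto
    then obtain a where "(a, m) \<in> set p" by auto
    then obtain q s where q: "p = q @ (a, m) # s" by (meson split_list)
    txt \<open>Rotate the cycle so that it starts and ends in its largest vertex.\<close>
    define c where "c = s @ q"
    have am: "(a, m) \<in> parcs ?G" and "awalk u q a" "awalk m s u"
      using p(1) unfolding q by (auto simp: awalk_Cons_iff)
    then have c_walk: "awalk m c a"
      unfolding c_def by (intro awalk_appendI)
    \<comment> \<open>This makes the first and the last arc of \<open>c\<close> different, so that
      \<open>a\<close> and \<open>b\<close> are heads at different positions.\<close>
    have "length c \<ge> 2"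
      using \<open>\<not> length p < 3\<close> q by (simp add: c_def)
    then obtain b c' where c: "c = (m, b) # c'" and mb: "(m, b) \<in> parcs ?G"
      and c': "awalk b c' a" "c' \<noteq> []"
      using c_walk by (cases c) (fastforce simp: awalk_Cons_iff)+
    have "snd (last c') = a"
      using c' by (auto simp: awalk_verts_conv)
    then have a: "a \<in> snd ` set c'"
      using c'(2) by force
    have "set c \<subseteq> set p" by (auto simp: c_def q)
    then have "snd ` set c \<subseteq> {..m}"
      unfolding m_def by (force intro: Max_ge)
    then have "a \<le> m" "b \<le> m" using a c by auto
    \<comment> \<open>A neighbour of \<open>m\<close> that is not its parent is a child of
      \<open>m\<close> and hence larger than \<open>m\<close>.\<close>
    then have "a = f m" "b = f m"
      using am mb f[of a] f[of b] by (auto simp: parent_graph_def)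
    moreover have "distinct (map snd c)"
      using heads by (auto simp: c_def q)
    ultimately show False using a c by auto
  qed
  ultimately show ?thesis
    using \<open>pair_graph ?G\<close> unfolding undirected_tree_def by (meson leD)
qed

text \<open>The centre is \<open>0\<close>, the subdivision vertices are \<open>1\<close> to
  \<open>k\<close>, and \<open>i + k\<close> is the outer end of the leg through \<open>i\<close>.
  For even \<open>n\<close> the extra vertex \<open>2 * k + 1\<close> hangs directly at the
  centre.\<close>

definition spider_parent :: "nat \<Rightarrow> nat \<Rightarrow> nat" where
  "spider_parent k i = (if k < i \<and> i \<le> 2 * k then i - k else 0)"

text \<open>Choosing for each outer edge, joining \<open>i\<close> and \<open>i + k\<close>, an
  element of \<open>S\<close> that covers one of its ends gives an injection \<open>g\<close> from
  \<open>{1..k}\<close> into \<open>S\<close>.\<close>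

lemma isolating_set_spider_card_ge:
  assumes "2 * k < n" and graph: "pair_graph (parent_graph n (spider_parent k))"
    and iso: "isolating_set (middle_graph (parent_graph n (spider_parent k))) S"
  shows "k \<le> card S"
proof -
  let ?T = "parent_graph n (spider_parent k)"
  define leg where "leg = (\<lambda>i x. case x of Inl v \<Rightarrow> v = i \<or> v = i + k | Inr e \<Rightarrow> i \<in> e \<or> i + k \<in> e)"
  have S: "S \<subseteq> pverts (middle_graph ?T)"
    using iso by (simp add: isolating_set_def)
  interpret M: pair_graph "middle_graph ?T"
    using graph by (rule pair_graph_middle_graph)
  have "finite S" using S M.pair_finite_verts finite_subset by blast
  have "\<forall>i\<in>{1..k}. \<exists>x. x \<in> S \<and> leg i x"
  proof
    fix i assume i: "i \<in> {1..k}"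
    have "(i + k, i) \<in> parcs ?T"
      using i assms(1) by (auto simp: parent_graph_def spider_parent_def)
    then have "i \<in> mid_cover S \<or> i + k \<in> mid_cover S"
      using iso graph by (auto simp: isolating_set_middle_graph_iff)
    then show "\<exists>x. x \<in> S \<and> leg i x"
      by (force simp: mid_cover_def leg_def)
  qed
  then obtain g where g: "\<forall>i\<in>{1..k}. g i \<in> S \<and> leg i (g i)"
    using bchoice by (metis (lifting))
  have uniq: "i = j" if "x \<in> S" "leg i x" "leg j x" "i \<in> {1..k}" "j \<in> {1..k}" for i j x
  proof (cases x)
    case (Inl v)
    then show ?thesis using that by (auto simp: leg_def)
  next
    case (Inr e)
    then have "e \<in> undirected_edges ?T"
      using that S by (auto simp: middle_graph_def)
    \<comment> \<open>Such an edge either is an outer edge or contains the centre \<open>0\<close>,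
      which lies on no outer edge; so it meets at most one of them.\<close>
    then obtain a where "e = {a, spider_parent k a}"
      by (auto simp: undirected_edges_def parent_graph_def)
    then show ?thesis
      using that Inr by (auto simp: leg_def spider_parent_def split: if_splits)
  qed
  have "inj_on g {1..k}"
    using g uniq by (metis inj_onI)
  then have "card {1..k} \<le> card S"
    using g \<open>finite S\<close> by (intro card_inj_on_le) auto
  then show ?thesis by simp
qed

theorem theorem3:
  fixes n :: nat
  assumes "n \<ge> 3"
  shows "(\<forall>T :: 'a pair_pre_digraph. undirected_tree T \<and> card (pverts T) = n \<longrightarrow>
            isolation_number (middle_graph T) \<le> (n - 1) div 2) \<and>
         (\<exists>T :: nat pair_pre_digraph. undirected_tree T \<and> card (pverts T) = n \<and>
            isolation_number (middle_graph T) = (n - 1) div 2)"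
proof (intro conjI allI impI)
  fix T :: "'a pair_pre_digraph"
  assume "undirected_tree T \<and> card (pverts T) = n"
  then show "isolation_number (middle_graph T) \<le> (n - 1) div 2"
    using isolation_number_middle_tree_le assms by blast
next
  define k where "k = (n - 1) div 2"
  let ?T = "parent_graph n (spider_parent k)"
  have tree: "undirected_tree ?T"
    using assms by (intro undirected_tree_parent_graph) (auto simp: spider_parent_def k_def)
  have card: "card (pverts ?T) = n" by (simp add: parent_graph_def)
  obtain S where S: "isolating_set (middle_graph ?T) S" "card S = isolation_number (middle_graph ?T)"
    by (rule isolation_number_attained)
  have "k \<le> card S"
    using tree S(1) assms
    by (intro isolating_set_spider_card_ge[of k n]) (auto simp: undirected_tree_def k_def)
  \<comment> \<open>The general upper bound applies to the spider itself, so no explicit isolating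
    set of size \<open>k\<close> has to be given.\<close>
  moreover have "isolation_number (middle_graph ?T) \<le> k"
    using isolation_number_middle_tree_le[OF tree] card assms by (simp add: k_def)
  ultimately show "\<exists>T :: nat pair_pre_digraph. undirected_tree T \<and> card (pverts T) = n \<and>
      isolation_number (middle_graph T) = (n - 1) div 2"
    using tree card S(2) unfolding k_def by (intro exI[of _ ?T]) (auto simp: k_def)
qed

end
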